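(* Assume there is $C_g>0$ such that for all $w,z\in\mathbf H$ $$\|g(w)\|_\infty\le C_g,\qquad \|g(w)-g(z)\|\le C_g\|w-z\|,\qquad \|(-\Delta)^{1/2}g(w)Q^{1/2}\|_{HS}\le C_g .$$ Then the auxiliary-variable-based pressure-correction scheme for the 2D stochastic Navier–Stokes equation (defined in the context) is unconditionally stable (no restriction on the time step $\tau>0$) in the sense that, for all $m\ge1$, $$\mathbf E\|u^{n+1}\|^{2m}+\mathbf E\Big(\tau\sum_{j=0}^n\|\nabla\tilde u^{j+1}\|^2\Big)^m+\mathbf E|\xi^{n+1}|^{2m}+\mathbf E|\eta^{n+1}|^{2m}+\tau^{2m}\,\mathbf E\|\nabla p^{n+1}\|^{2m}<\infty$$ for all $n\ge0$ with $t_{n+1}\le T$.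
   Context: $(\Omega,\mathcal F,\{\mathcal F_t\}_{t\ge0},\mathbf P)$ is a filtered probability space, $\mathbf E$ is expectation, $\mathcal O=[0,1]^2$ and $T>0$ is fixed. $(\cdot,\cdot)$ and $\|\cdot\|$ denote the inner product and norm of $\mathbf L^2(\mathcal O)$ (vector fields with values in $\mathbb R^2$), $\|\cdot\|_{HS}$ is the Hilbert–Schmidt norm, $-\Delta$ in the assumption on $g$ is the Dirichlet Laplacian, and $$\mathbf H=\{w\in\mathbf L^2(\mathcal O):\nabla\cdot w=0\},\qquad \mathbf V=\{w\in\mathbf H^1(\mathcal O):\nabla\cdot w=0\}.$$ Noise: $W(t)=\sum_{j\ge1}\sqrt{q_j}\,e_j\beta_j(t)$ is a $Q$-Wiener process with values in $\mathbf L^2(\mathcal O)$, where the $\beta_j$ are independent standard Brownian motions, $(q_j,e_j)$ are the eigenpairs ($e_j$ orthonormal) of a symmetric positive-definite operator $Q$, and $\operatorname{tr}(Q)=\sum_jq_j<\infty$. The expression $g(u)\chi$ is the pointwise product $(g(u)\chi)(x)=g(u)(x)\chi(x)$. Equation being approximated: $du=\Delta u\,dt-[u\cdot\nabla]u\,dt-\nabla p\,dt+g(u)\,dW(t)$, $\operatorname{div}u=0$, $u(0)=u_0$ on $\mathcal O$ with homogeneous Dirichlet boundary condition. Scheme: $\tau>0$, $t_n=n\tau$, $\delta W^n=W(t_{n+1})-W(t_n)$, $\mathbf n$ is the outward unit normal to $\partial\mathcal O$; $u^0=u_0\in\mathbf V$, $\xi^0=1$, $\eta^0=1$, and $p^0$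 is a given initial pressure with $\nabla p^0\in\mathbf L^2(\mathcal O)$. Given the quantities at level $n$, those at level $n+1$ solve $$\tilde u^{n+1}-u^n=\tau\Delta\tilde u^{n+1}-\tau\xi^{n+1}[u^n\cdot\nabla]u^n-\tau\nabla p^n+\eta^{n+1}g(u^n)\delta W^n,\qquad \tilde u^{n+1}|_{\partial\mathcal O}=0,$$ $$u^{n+1}-\tilde u^{n+1}+\tau(\nabla p^{n+1}-\nabla p^n)=0,\qquad \nabla\cdot u^{n+1}=0,\qquad u^{n+1}\cdot\mathbf n|_{\partial\mathcal O}=0,$$ $$\xi^{n+1}-\xi^n=\tau([u^n\cdot\nabla]u^n,\tilde u^{n+1}),$$ $$\eta^{n+1}-\eta^n=-(g(u^n)\delta W^n,\ \tilde u^{n+1}-u^n-g(u^n)\delta W^n).$$ *)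

theory Defs
  imports "HOL-Probability.Probability"
begin

definition unit_square :: "(real^2) set" where
  "unit_square = cbox 0 1"

abbreviation square_measure :: "(real^2) measure" where
  "square_measure \<equiv> lebesgue_on unit_square"

definition square_integrable :: "(real^2 \<Rightarrow> 'b::euclidean_space) \<Rightarrow> bool" where
  "square_integrable f \<longleftrightarrow>
     f \<in> borel_measurable square_measure \<and>
     integrable square_measure (\<lambda>x. (norm (f x))\<^sup>2)"

definition l2_eq :: "(real^2 \<Rightarrow> 'b::euclidean_space) \<Rightarrow> (real^2 \<Rightarrow> 'b) \<Rightarrow> bool" where
  "l2_eq f g \<longleftrightarrow> square_integrable f \<and> square_integrable g \<and>
     (AE x in square_measure. f x = g x)"

lemma square_integrable_zero: "square_integrable (\<lambda>x. 0)"
  by (simp add: square_integrable_def)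

lemma square_integrable_scaleR:
  "square_integrable f \<Longrightarrow> square_integrable (\<lambda>x. c *\<^sub>R f x)"
  by (auto simp: square_integrable_def power_mult_distrib)

lemma square_integrable_add:
  assumes "square_integrable f" "square_integrable g"
  shows "square_integrable (\<lambda>x. f x + g x)"
  unfolding square_integrable_def
proof
  have [measurable]: "f \<in> borel_measurable square_measure" "g \<in> borel_measurable square_measure"
    using assms by (auto simp: square_integrable_def)
  show "(\<lambda>x. f x + g x) \<in> borel_measurable square_measure"
    by measurable
  show "integrable square_measure (\<lambda>x. (norm (f x + g x))\<^sup>2)"
  proof (rule Bochner_Integration.integrable_bound)
    show "integrable square_measure (\<lambda>x. 2 * (norm (f x))\<^sup>2 + 2 * (norm (g x))\<^sup>2)"
      using assms by (auto simp: square_integrable_def)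
    have "(norm (a + b))\<^sup>2 \<le> 2 * (norm a)\<^sup>2 + 2 * (norm b)\<^sup>2" for a b :: 'a
    proof -
      have "(norm (a + b))\<^sup>2 \<le> (norm a + norm b)\<^sup>2"
        by (intro power_mono norm_triangle_ineq) auto
      also have "\<dots> \<le> 2 * (norm a)\<^sup>2 + 2 * (norm b)\<^sup>2"
        using sum_squares_bound[of "norm a" "norm b"] by (simp add: power2_sum)
      finally show ?thesis .
    qed
    then show "AE x in square_measure. norm ((norm (f x + g x))\<^sup>2)
        \<le> norm (2 * (norm (f x))\<^sup>2 + 2 * (norm (g x))\<^sup>2)"
      by simp
  qed measurable
qed

lemma square_integrable_uminus: "square_integrable f \<Longrightarrow> square_integrable (\<lambda>x. - f x)"
  using square_integrable_scaleR[of f "-1"] by simp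

lemma square_integrable_diff:
  "square_integrable f \<Longrightarrow> square_integrable g \<Longrightarrow> square_integrable (\<lambda>x. f x - g x)"
  using square_integrable_add[OF _ square_integrable_uminus, of f g] by simp

lemma integrable_inner_square_integrable:
  assumes "square_integrable f" "square_integrable g"
  shows "integrable square_measure (\<lambda>x. f x \<bullet> g x)"
proof (rule Bochner_Integration.integrable_bound)
  have [measurable]: "f \<in> borel_measurable square_measure" "g \<in> borel_measurable square_measure"
    using assms by (auto simp: square_integrable_def)
  show "integrable square_measure (\<lambda>x. (norm (f x))\<^sup>2 + (norm (g x))\<^sup>2)"
    using assms by (auto simp: square_integrable_def)
  show "(\<lambda>x. f x \<bullet> g x) \<in> borel_measurable square_measure"
    by measurable
  have "\<bar>a \<bullet> b\<bar> \<le> (norm a)\<^sup>2 + (norm b)\<^sup>2" for a b :: 'a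
  proof -
    have "\<bar>a \<bullet> b\<bar> \<le> norm a * norm b"
      by (rule Cauchy_Schwarz_ineq2)
    also have "\<dots> \<le> 2 * norm a * norm b"
      by simp
    also have "\<dots> \<le> (norm a)\<^sup>2 + (norm b)\<^sup>2"
      by (rule sum_squares_bound)
    finally show ?thesis .
  qed
  then show "AE x in square_measure. norm (f x \<bullet> g x) \<le> norm ((norm (f x))\<^sup>2 + (norm (g x))\<^sup>2)"
    by simp
qed

quotient_type (overloaded) 'b l2 = "real^2 \<Rightarrow> 'b::euclidean_space" / partial: l2_eq
proof (rule part_equivpI)
  show "\<exists>f::real^2 \<Rightarrow> 'b. l2_eq f f"
    using square_integrable_zero by (auto simp: l2_eq_def)
  show "symp (l2_eq :: (real^2 \<Rightarrow> 'b) \<Rightarrow> _)"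
    by (auto simp: symp_def l2_eq_def)
  show "transp (l2_eq :: (real^2 \<Rightarrow> 'b) \<Rightarrow> _)"
    by (auto simp: transp_def l2_eq_def)
qed

instantiation l2 :: (euclidean_space) real_inner
begin

lift_definition zero_l2 :: "'a l2" is "\<lambda>x. 0"
  by (simp add: l2_eq_def square_integrable_zero)

lift_definition plus_l2 :: "'a l2 \<Rightarrow> 'a l2 \<Rightarrow> 'a l2" is "\<lambda>f g x. f x + g x"
  by (auto simp: l2_eq_def square_integrable_add)

lift_definition uminus_l2 :: "'a l2 \<Rightarrow> 'a l2" is "\<lambda>f x. - f x"
  by (auto simp: l2_eq_def square_integrable_uminus)

lift_definition minus_l2 :: "'a l2 \<Rightarrow> 'a l2 \<Rightarrow> 'a l2" is "\<lambda>f g x. f x - g x"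
  by (auto simp: l2_eq_def square_integrable_diff)

lift_definition scaleR_l2 :: "real \<Rightarrow> 'a l2 \<Rightarrow> 'a l2" is "\<lambda>c f x. c *\<^sub>R f x"
  by (auto simp: l2_eq_def square_integrable_scaleR)

lift_definition inner_l2 :: "'a l2 \<Rightarrow> 'a l2 \<Rightarrow> real" is
  "\<lambda>f g. \<integral>x. f x \<bullet> g x \<partial>square_measure"
proof -
  fix f f' g g' :: "real^2 \<Rightarrow> 'a"
  assume ff: "l2_eq f f'" and gg: "l2_eq g g'"
  have [measurable]: "f \<in> borel_measurable square_measure" "g \<in> borel_measurable square_measure"
    "f' \<in> borel_measurable square_measure" "g' \<in> borel_measurable square_measure"
    using ff gg by (auto simp: l2_eq_def square_integrable_def)
  have "AE x in square_measure. f x = f' x" "AE x in square_measure. g x = g' x"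
    using ff gg by (auto simp: l2_eq_def)
  then have "AE x in square_measure. f x \<bullet> g x = f' x \<bullet> g' x"
    by eventually_elim simp
  then show "(\<integral>x. f x \<bullet> g x \<partial>square_measure) = (\<integral>x. f' x \<bullet> g' x \<partial>square_measure)"
    by (intro integral_cong_AE) measurable
qed

definition norm_l2 :: "'a l2 \<Rightarrow> real" where "norm_l2 f = sqrt (f \<bullet> f)"

definition dist_l2 :: "'a l2 \<Rightarrow> 'a l2 \<Rightarrow> real" where "dist_l2 f g = norm (f - g)"

definition sgn_l2 :: "'a l2 \<Rightarrow> 'a l2" where "sgn_l2 f = inverse (norm f) *\<^sub>R f"

definition uniformity_l2 :: "('a l2 \<times> 'a l2) filter" where
  "uniformity_l2 = (INF e\<in>{0<..}. principal {(f, g). dist f g < e})"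

definition open_l2 :: "'a l2 set \<Rightarrow> bool" where
  "open_l2 U \<longleftrightarrow> (\<forall>f\<in>U. \<forall>\<^sub>F (f', g) in uniformity. f' = f \<longrightarrow> g \<in> U)"

instance
proof
  fix f g h :: "'a l2" and r s :: real
  show "f + g + h = f + (g + h)"
    by transfer (auto simp: l2_eq_def add.assoc square_integrable_add)
  show "f + g = g + f"
    by transfer (auto simp: l2_eq_def add.commute square_integrable_add)
  show "0 + f = f"
    by transfer (auto simp: l2_eq_def)
  show "- f + f = 0"
    by transfer (auto simp: l2_eq_def square_integrable_zero)
  show "f - g = f + - g"
    by transfer (auto simp: l2_eq_def square_integrable_diff)
  show "r *\<^sub>R (f + g) = r *\<^sub>R f + r *\<^sub>R g"
    by transfer (auto simp: l2_eq_def scaleR_add_right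
        intro!: square_integrable_add square_integrable_scaleR)
  show "(r + s) *\<^sub>R f = r *\<^sub>R f + s *\<^sub>R f"
    by transfer (auto simp: l2_eq_def scaleR_add_left
        intro!: square_integrable_add square_integrable_scaleR)
  show "r *\<^sub>R s *\<^sub>R f = (r * s) *\<^sub>R f"
    by transfer (auto simp: l2_eq_def intro!: square_integrable_scaleR)
  show "1 *\<^sub>R f = f"
    by transfer (auto simp: l2_eq_def)
  show "dist f g = norm (f - g)"
    by (rule dist_l2_def)
  show "sgn f = inverse (norm f) *\<^sub>R f"
    by (rule sgn_l2_def)
  show "(uniformity :: ('a l2 \<times> 'a l2) filter) = (INF e\<in>{0<..}. principal {(f, g). dist f g < e})"
    by (rule uniformity_l2_def)
  show "open U \<longleftrightarrow> (\<forall>f\<in>U. \<forall>\<^sub>F (f', g) in uniformity. f' = f \<longrightarrow> g \<in> U)" for U :: "'a l2 set"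
    by (rule open_l2_def)
  show "f \<bullet> g = g \<bullet> f"
    by transfer (simp add: inner_commute)
  show "(f + g) \<bullet> h = f \<bullet> h + g \<bullet> h"
    by transfer (simp add: l2_eq_def inner_add_left integrable_inner_square_integrable)
  show "(r *\<^sub>R f) \<bullet> g = r * (f \<bullet> g)"
    by transfer simp
  show "0 \<le> f \<bullet> f"
    by transfer (simp add: integral_nonneg_AE)
  show "f \<bullet> f = 0 \<longleftrightarrow> f = 0"
  proof transfer
    fix f :: "real^2 \<Rightarrow> 'a"
    assume "l2_eq f f"
    then have f: "square_integrable f"
      by (simp add: l2_eq_def)
    have "(\<integral>x. f x \<bullet> f x \<partial>square_measure) = 0 \<longleftrightarrow> (AE x in square_measure. f x \<bullet> f x = 0)"
      by (intro integral_nonneg_eq_0_iff_AE integrable_inner_square_integrable f) auto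
    then show "(\<integral>x. f x \<bullet> f x \<partial>square_measure) = 0 \<longleftrightarrow> l2_eq f (\<lambda>x. 0)"
      using f by (simp add: l2_eq_def square_integrable_zero)
  qed
  show "norm f = sqrt (f \<bullet> f)"
    by (rule norm_l2_def)
qed

end

type_synonym vfield = "(real^2) l2"

type_synonym mfield = "(real^2^2) l2"

text \<open>Junk value \<open>0\<close> if the function is not square integrable.\<close>

definition l2_of :: "(real^2 \<Rightarrow> 'b::euclidean_space) \<Rightarrow> 'b l2" where
  "l2_of f = (if square_integrable f then abs_l2 f else 0)"

definition linf_norm :: "'b::euclidean_space l2 \<Rightarrow> ereal" where
  "linf_norm f = esssup square_measure (\<lambda>x. ereal (norm (rep_l2 f x)))"

text \<open>The multiplier is matrix valued. A scalar multiplier \<open>a\<close> is \<open>a(x) I\<close>, a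
  componentwise one is a diagonal matrix; the norm on \<^typ>\<open>real^2^2\<close> is the Frobenius norm.\<close>

definition pointwise_mult :: "mfield \<Rightarrow> vfield \<Rightarrow> vfield" where
  "pointwise_mult A v = l2_of (\<lambda>x. rep_l2 A x *v rep_l2 v x)"

definition partial_deriv :: "2 \<Rightarrow> (real^2 \<Rightarrow> 'b::real_normed_vector) \<Rightarrow> real^2 \<Rightarrow> 'b" where
  "partial_deriv j f x = frechet_derivative f (at x) (axis j 1)"

text \<open>\<open>C\<^sup>\<infinity>\<close>: every iterated partial derivative is (totally) differentiable everywhere.\<close>

definition smooth :: "(real^2 \<Rightarrow> 'b::real_normed_vector) \<Rightarrow> bool" where
  "smooth f \<longleftrightarrow> (\<forall>js x. foldr partial_deriv js f differentiable at x)"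

definition test_function :: "(real^2 \<Rightarrow> 'b::real_normed_vector) \<Rightarrow> bool" where
  "test_function f \<longleftrightarrow> smooth f \<and>
     (\<exists>K. compact K \<and> K \<subseteq> interior unit_square \<and> (\<forall>x. x \<notin> K \<longrightarrow> f x = 0))"

definition weak_gradient :: "real l2 \<Rightarrow> vfield \<Rightarrow> bool" where
  "weak_gradient p G \<longleftrightarrow> (\<forall>\<phi>::real^2 \<Rightarrow> real. test_function \<phi> \<longrightarrow> (\<forall>j.
     (\<integral>x. rep_l2 p x * partial_deriv j \<phi> x \<partial>square_measure) =
     - (\<integral>x. rep_l2 G x $ j * \<phi> x \<partial>square_measure)))"

text \<open>Convention: entry \<open>(i, j)\<close> of the gradient of a vector field \<open>v\<close> is \<open>\<partial>\<^sub>j v\<^sub>i\<close>.\<close>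

definition weak_vgradient :: "vfield \<Rightarrow> mfield \<Rightarrow> bool" where
  "weak_vgradient v G \<longleftrightarrow> (\<forall>\<phi>::real^2 \<Rightarrow> real. test_function \<phi> \<longrightarrow> (\<forall>i j.
     (\<integral>x. rep_l2 v x $ i * partial_deriv j \<phi> x \<partial>square_measure) =
     - (\<integral>x. rep_l2 G x $ i $ j * \<phi> x \<partial>square_measure)))"

definition weak_divergence :: "vfield \<Rightarrow> real l2 \<Rightarrow> bool" where
  "weak_divergence v d \<longleftrightarrow> (\<forall>\<phi>::real^2 \<Rightarrow> real. test_function \<phi> \<longrightarrow>
     (\<integral>x. (\<Sum>j\<in>UNIV. rep_l2 v x $ j * partial_deriv j \<phi> x) \<partial>square_measure) =
     - (\<integral>x. rep_l2 d x * \<phi> x \<partial>square_measure))"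

definition H1 :: "real l2 set" where
  "H1 = {p. \<exists>G. weak_gradient p G}"

definition vH1 :: "vfield set" where
  "vH1 = {v. \<exists>G. weak_vgradient v G}"

definition Hdiv :: "vfield set" where
  "Hdiv = {v. \<exists>d. weak_divergence v d}"

text \<open>Weak derivatives are unique in \<open>L\<^sup>2\<close>, so the choices below are determined
  on \<open>H1\<close>, \<open>vH1\<close> and \<open>Hdiv\<close>.\<close>

definition grad :: "real l2 \<Rightarrow> vfield" where
  "grad p = (SOME G. weak_gradient p G)"

definition vgrad :: "vfield \<Rightarrow> mfield" where
  "vgrad v = (SOME G. weak_vgradient v G)"

definition div_field :: "vfield \<Rightarrow> real l2" where
  "div_field v = (SOME d. weak_divergence v d)"

definition space_H :: "vfield set" where
  "space_H = {w \<in> Hdiv. div_field w = 0}"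

definition space_V :: "vfield set" where
  "space_V = {w \<in> vH1 \<inter> Hdiv. div_field w = 0}"

text \<open>Vector fields in \<open>H\<^sup>1\<close> with zero boundary trace: closure of the test fields in the
  \<open>H\<^sup>1\<close> norm.\<close>

definition vH10 :: "vfield set" where
  "vH10 = {v \<in> vH1. \<exists>\<phi>::nat \<Rightarrow> real^2 \<Rightarrow> real^2. (\<forall>k. test_function (\<phi> k)) \<and>
     (\<lambda>k. l2_of (\<phi> k)) \<longlonglongrightarrow> v \<and> (\<lambda>k. vgrad (l2_of (\<phi> k))) \<longlonglongrightarrow> vgrad v}"

text \<open>The normal trace \<open>v \<cdot> n\<close> on the boundary of \<open>v\<close> in \<open>Hdiv\<close>, as the functional on traces
  of \<open>H\<^sup>1\<close> functions \<open>q\<close> given by Green's formula.\<close>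

definition normal_trace :: "vfield \<Rightarrow> real l2 \<Rightarrow> real" where
  "normal_trace v q = v \<bullet> grad q + div_field v \<bullet> q"

text \<open>\<open>[u \<cdot> \<nabla>]u\<close> is in general not in \<open>L\<^sup>2\<close> for \<open>u\<close> in \<open>H\<^sup>1\<close>. Its \<open>L\<^sup>2\<close> pairing with \<open>v\<close> in
  \<open>H\<^sup>1\<close> is the integral \<open>convection_pairing u v\<close>, convergent by Sobolev embedding.\<close>

definition convection :: "vfield \<Rightarrow> real^2 \<Rightarrow> real^2" where
  "convection u x = rep_l2 (vgrad u) x *v rep_l2 u x"

definition convection_pairing :: "vfield \<Rightarrow> vfield \<Rightarrow> real" where
  "convection_pairing u v = (\<integral>x. convection u x \<bullet> rep_l2 v x \<partial>square_measure)"

text \<open>Square root of the Dirichlet Laplacian (acting componentwise) by its spectral expansion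
  on the unit square.\<close>

definition sine_mode :: "nat \<Rightarrow> nat \<Rightarrow> real^2 \<Rightarrow> real" where
  "sine_mode k l x = 2 * sin (real k * pi * x $ 1) * sin (real l * pi * x $ 2)"

definition dirichlet_eigenvalue :: "nat \<Rightarrow> nat \<Rightarrow> real" where
  "dirichlet_eigenvalue k l = pi\<^sup>2 * ((real k)\<^sup>2 + (real l)\<^sup>2)"

definition sine_coeff :: "nat \<Rightarrow> nat \<Rightarrow> vfield \<Rightarrow> real^2" where
  "sine_coeff k l v = (\<integral>x. sine_mode k l x *\<^sub>R rep_l2 v x \<partial>square_measure)"

definition sqrt_laplace_term :: "vfield \<Rightarrow> nat \<times> nat \<Rightarrow> vfield" where
  "sqrt_laplace_term v = (\<lambda>(k, l). sqrt (dirichlet_eigenvalue k l) *\<^sub>R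
     l2_of (\<lambda>x. sine_mode k l x *\<^sub>R sine_coeff k l v))"

definition sqrt_laplace_dom :: "vfield set" where
  "sqrt_laplace_dom = {v. sqrt_laplace_term v summable_on {1..} \<times> {1..}}"

definition sqrt_laplace :: "vfield \<Rightarrow> vfield" where
  "sqrt_laplace v = infsum (sqrt_laplace_term v) ({1..} \<times> {1..})"

definition symmetric_op :: "(vfield \<Rightarrow> vfield) \<Rightarrow> bool" where
  "symmetric_op A \<longleftrightarrow> bounded_linear A \<and> (\<forall>v w. A v \<bullet> w = v \<bullet> A w)"

definition op_sqrt :: "(vfield \<Rightarrow> vfield) \<Rightarrow> vfield \<Rightarrow> vfield" where
  "op_sqrt A = (THE B. symmetric_op B \<and> (\<forall>v. 0 \<le> B v \<bullet> v) \<and> B \<circ> B = A)"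

definition orthonormal_basis :: "(nat \<Rightarrow> vfield) \<Rightarrow> bool" where
  "orthonormal_basis e \<longleftrightarrow> (\<forall>i j. e i \<bullet> e j = (if i = j then 1 else 0)) \<and>
     closure (span (range e)) = UNIV"

text \<open>Squared Hilbert--Schmidt norm; it does not depend on the orthonormal basis.\<close>

definition hs_norm_sq :: "(nat \<Rightarrow> vfield) \<Rightarrow> (vfield \<Rightarrow> vfield) \<Rightarrow> ennreal" where
  "hs_norm_sq e A = (\<Sum>j. ennreal ((norm (A (e j)))\<^sup>2))"

definition covariance_op ::
  "(vfield \<Rightarrow> vfield) \<Rightarrow> (nat \<Rightarrow> real) \<Rightarrow> (nat \<Rightarrow> vfield) \<Rightarrow> bool" where
  "covariance_op Q q e \<longleftrightarrow>
     symmetric_op Q \<and> (\<forall>v. v \<noteq> 0 \<longrightarrow> 0 < Q v \<bullet> v) \<and>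
     orthonormal_basis e \<and> (\<forall>j. Q (e j) = q j *\<^sub>R e j) \<and> summable q"

definition noise_coefficient ::
  "(vfield \<Rightarrow> vfield) \<Rightarrow> (nat \<Rightarrow> vfield) \<Rightarrow> real \<Rightarrow> (vfield \<Rightarrow> mfield) \<Rightarrow> bool" where
  "noise_coefficient Q e C g \<longleftrightarrow> (\<forall>w\<in>space_H. \<forall>z\<in>space_H.
     linf_norm (g w) \<le> ereal C \<and>
     norm (g w - g z) \<le> C * norm (w - z) \<and>
     (\<forall>v. pointwise_mult (g w) (op_sqrt Q v) \<in> sqrt_laplace_dom) \<and>
     hs_norm_sq e (\<lambda>v. sqrt_laplace (pointwise_mult (g w) (op_sqrt Q v))) \<le> ennreal (C\<^sup>2))"

definition standard_brownian_motion :: "'w measure \<Rightarrow> (real \<Rightarrow> 'w \<Rightarrow> real) \<Rightarrow> bool" where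
  "standard_brownian_motion M \<beta> \<longleftrightarrow>
     (\<forall>t\<ge>0. \<beta> t \<in> borel_measurable M) \<and>
     (AE \<omega> in M. \<beta> 0 \<omega> = 0) \<and>
     (AE \<omega> in M. continuous_on {0..} (\<lambda>t. \<beta> t \<omega>)) \<and>
     (\<forall>s\<ge>0. \<forall>t>s. distributed M lborel (\<lambda>\<omega>. \<beta> t \<omega> - \<beta> s \<omega>) (normal_density 0 (sqrt (t - s)))) \<and>
     (\<forall>t::nat \<Rightarrow> real. 0 \<le> t 0 \<and> strict_mono t \<longrightarrow>
        prob_space.indep_vars M (\<lambda>_. borel) (\<lambda>i \<omega>. \<beta> (t (Suc i)) \<omega> - \<beta> (t i) \<omega>) UNIV)"

text \<open>The filtration is indexed by all reals, but only nonnegative times are used.\<close>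

definition filtered_prob_space :: "'w measure \<Rightarrow> (real \<Rightarrow> 'w measure) \<Rightarrow> bool" where
  "filtered_prob_space M F \<longleftrightarrow>
     prob_space M \<and> filtration (space M) F \<and> (\<forall>t. subalgebra M (F t))"

text \<open>\<open>W(t) = \<Sum>\<^sub>j \<surd>q\<^sub>j e\<^sub>j \<beta>\<^sub>j(t)\<close> with the series converging in \<open>L\<^sup>2\<close> almost surely, adapted and
  with increments independent of the past. The index \<open>j\<close> starts at \<open>0\<close>.\<close>

definition Q_wiener ::
  "'w measure \<Rightarrow> (real \<Rightarrow> 'w measure) \<Rightarrow> (nat \<Rightarrow> real) \<Rightarrow> (nat \<Rightarrow> vfield) \<Rightarrow>
   (nat \<Rightarrow> real \<Rightarrow> 'w \<Rightarrow> real) \<Rightarrow> (real \<Rightarrow> 'w \<Rightarrow> vfield) \<Rightarrow> bool" where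
  "Q_wiener M F q e \<beta> W \<longleftrightarrow>
     (\<forall>j. standard_brownian_motion M (\<beta> j)) \<and>
     prob_space.indep_vars M (\<lambda>_. Pi\<^sub>M {0..} (\<lambda>_. borel)) (\<lambda>j \<omega>. \<lambda>t\<in>{0..}. \<beta> j t \<omega>) UNIV \<and>
     (\<forall>t\<ge>0. AE \<omega> in M. (\<lambda>j. (sqrt (q j) * \<beta> j t \<omega>) *\<^sub>R e j) sums W t \<omega>) \<and>
     (AE \<omega> in M. continuous_on {0..} (\<lambda>t. W t \<omega>)) \<and>
     (\<forall>t\<ge>0. W t \<in> borel_measurable (F t)) \<and>
     (\<forall>s\<ge>0. \<forall>t>s. prob_space.indep_set M (sets (F s))
        {(\<lambda>\<omega>. W t \<omega> - W s \<omega>) -` A \<inter> space M | A. A \<in> sets borel})"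

text \<open>One step along a sample path: \<open>u, p, \<xi>, \<eta>\<close> at the old level, \<open>\<delta>\<close> the noise increment,
  \<open>ut', u', p', \<xi>', \<eta>'\<close> at the new level. The momentum equation with the Dirichlet condition for
  \<open>ut'\<close> is understood in the dual of \<open>vH10\<close>; \<open>u'\<close> has to lie in \<open>H\<^sup>1\<close> for the convection term of
  the next step.\<close>

definition scheme_step ::
  "real \<Rightarrow> (vfield \<Rightarrow> mfield) \<Rightarrow> vfield \<Rightarrow>
   vfield \<Rightarrow> real l2 \<Rightarrow> real \<Rightarrow> real \<Rightarrow>
   vfield \<Rightarrow> vfield \<Rightarrow> real l2 \<Rightarrow> real \<Rightarrow> real \<Rightarrow> bool" where
  "scheme_step \<tau> g \<delta> u p \<xi> \<eta> ut' u' p' \<xi>' \<eta>' \<longleftrightarrow>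
     ut' \<in> vH10 \<and>
     (\<forall>v\<in>vH10. (ut' - u) \<bullet> v =
        - \<tau> * (vgrad ut' \<bullet> vgrad v) - \<tau> * \<xi>' * convection_pairing u v
        - \<tau> * (grad p \<bullet> v) + \<eta>' * (pointwise_mult (g u) \<delta> \<bullet> v)) \<and>
     p' \<in> H1 \<and> u' - ut' + \<tau> *\<^sub>R (grad p' - grad p) = 0 \<and>
     u' \<in> space_V \<and> (\<forall>\<phi>\<in>H1. normal_trace u' \<phi> = 0) \<and>
     \<xi>' - \<xi> = \<tau> * convection_pairing u ut' \<and>
     \<eta>' - \<eta> = - (pointwise_mult (g u) \<delta> \<bullet> (ut' - u - pointwise_mult (g u) \<delta>))"

text \<open>Only levels up to time \<open>T\<close> are constrained; \<open>ut 0\<close> is irrelevant.\<close>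

definition scheme_solution ::
  "'w measure \<Rightarrow> real \<Rightarrow> real \<Rightarrow> (vfield \<Rightarrow> mfield) \<Rightarrow> (real \<Rightarrow> 'w \<Rightarrow> vfield) \<Rightarrow>
   vfield \<Rightarrow> real l2 \<Rightarrow> (nat \<Rightarrow> 'w \<Rightarrow> vfield) \<Rightarrow> (nat \<Rightarrow> 'w \<Rightarrow> vfield) \<Rightarrow>
   (nat \<Rightarrow> 'w \<Rightarrow> real l2) \<Rightarrow> (nat \<Rightarrow> 'w \<Rightarrow> real) \<Rightarrow> (nat \<Rightarrow> 'w \<Rightarrow> real) \<Rightarrow> bool" where
  "scheme_solution M T \<tau> g W u0 p0 ut u p \<xi> \<eta> \<longleftrightarrow>
     (\<forall>\<omega>\<in>space M. u 0 \<omega> = u0 \<and> p 0 \<omega> = p0 \<and> \<xi> 0 \<omega> = 1 \<and> \<eta> 0 \<omega> = 1) \<and>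
     (\<forall>n. real (Suc n) * \<tau> \<le> T \<longrightarrow>
        ut (Suc n) \<in> borel_measurable M \<and> (\<lambda>\<omega>. vgrad (ut (Suc n) \<omega>)) \<in> borel_measurable M \<and>
        u (Suc n) \<in> borel_measurable M \<and> (\<lambda>\<omega>. grad (p (Suc n) \<omega>)) \<in> borel_measurable M \<and>
        \<xi> (Suc n) \<in> borel_measurable M \<and> \<eta> (Suc n) \<in> borel_measurable M \<and>
        (AE \<omega> in M. scheme_step \<tau> g (W (real (Suc n) * \<tau>) \<omega> - W (real n * \<tau>) \<omega>)
           (u n \<omega>) (p n \<omega>) (\<xi> n \<omega>) (\<eta> n \<omega>)
           (ut (Suc n) \<omega>) (u (Suc n) \<omega>) (p (Suc n) \<omega>) (\<xi> (Suc n) \<omega>) (\<eta> (Suc n) \<omega>)))"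

end

theory Submission
  imports Defs
begin

text \<open>
  The scheme dissipates a modified energy along every sample path. Write \<open>u, p, \<xi>, \<eta>\<close> for the
  old level, \<open>ut', u', p', \<xi>', \<eta>'\<close> for the new one, \<open>\<delta>\<close> for the Wiener increment and
  \<open>E = \<parallel>u\<parallel>\<^sup>2 + \<tau>\<^sup>2 \<parallel>\<nabla>p\<parallel>\<^sup>2 + \<xi>\<^sup>2 + \<eta>\<^sup>2\<close>. Testing the momentum equation with \<open>ut'\<close>, multiplying the
  equations of the auxiliary variables by \<open>\<xi>'\<close> and \<open>\<eta>'\<close> and squaring the projection step
  \<open>u' + \<tau> \<nabla>p' = ut' + \<tau> \<nabla>p\<close>, where \<open>(u', \<nabla>p') = 0\<close>, makes the convection and pressure terms
  cancel exactly. What is left is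
  \<open>E' / 2 + \<tau> \<parallel>\<nabla>ut'\<parallel>\<^sup>2 \<le> E / 2 + \<eta>' ((g(u)\<delta>, u) + \<parallel>g(u)\<delta>\<parallel>\<^sup>2)\<close>.
  Young's inequality absorbs \<open>\<eta>'\<close> in the left-hand side (\<open>scheme_step_energy\<close>), and the
  uniform bound on \<open>g\<close> gives \<open>\<parallel>g(u)\<delta>\<parallel> \<le> C \<parallel>\<delta>\<parallel>\<close>. Hence both \<open>E'\<close> and \<open>\<tau> \<parallel>\<nabla>ut'\<parallel>\<^sup>2\<close> are
  bounded by a polynomial in \<open>E\<close> and \<open>\<parallel>\<delta>\<parallel>\<^sup>2\<close> (\<open>scheme_step_energy_noise\<close>).

  Random variables with finite moments of all orders are closed under sums and products, so
  induction on the time level reduces the claim to the moments of the Wiener increments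
  (\<open>dominated_moments_gaussian_series\<close>). By Parseval \<open>\<parallel>\<delta>\<parallel>\<^sup>2\<close> is the sum of the series of
  \<open>q\<^sub>j X\<^sub>j\<^sup>2\<close> with \<open>X\<^sub>j\<close> centred Gaussian of variance \<open>\<tau>\<close>. Jensen's inequality with the weights
  \<open>q\<^sub>j\<close> bounds its \<open>k\<close>-th power, for \<open>k \<ge> 1\<close>, by the \<open>(k - 1)\<close>-st power of
  the trace of \<open>Q\<close> times the series of \<open>q\<^sub>j (X\<^sub>j\<^sup>2)^k\<close>, whose expectation is finite because all \<open>X\<^sub>j\<close> have the same law.
\<close>

section \<open>Random variables with moments of all orders\<close>

text \<open>A real function on the sample space that is dominated almost everywhere by a measurable
  function with finite moments of all orders. The function itself need not be measurable:
  a Wiener increment is a difference of Borel measurable maps into a normed space, and its own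
  measurability would require a separability argument.\<close>

definition dominated_moments :: "'w measure \<Rightarrow> ('w \<Rightarrow> real) \<Rightarrow> bool" where
  "dominated_moments M X \<longleftrightarrow> (\<exists>Y\<in>borel_measurable M. (AE \<omega> in M. \<bar>X \<omega>\<bar> \<le> Y \<omega>) \<and>
     (\<forall>k::nat. integrable M (\<lambda>\<omega>. \<bar>Y \<omega>\<bar> ^ k)))"

lemma dominated_momentsE:
  assumes "dominated_moments M X"
  obtains Y where "Y \<in> borel_measurable M" "AE \<omega> in M. \<bar>X \<omega>\<bar> \<le> Y \<omega>"
    "\<And>k. integrable M (\<lambda>\<omega>. \<bar>Y \<omega>\<bar> ^ k)"
  using assms by (auto simp: dominated_moments_def)

lemma dominated_moments_mono_AE:
  assumes "dominated_moments M Y" "AE \<omega> in M. \<bar>X \<omega>\<bar> \<le> Y \<omega>"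
  shows "dominated_moments M X"
proof -
  obtain Z where Z: "Z \<in> borel_measurable M" "AE \<omega> in M. \<bar>Y \<omega>\<bar> \<le> Z \<omega>"
    "\<And>k. integrable M (\<lambda>\<omega>. \<bar>Z \<omega>\<bar> ^ k)"
    by (rule dominated_momentsE[OF assms(1)]) (rule that)
  have "AE \<omega> in M. \<bar>X \<omega>\<bar> \<le> Z \<omega>"
    using assms(2) Z(2) by eventually_elim linarith
  then show ?thesis
    using Z unfolding dominated_moments_def by blast
qed

lemma (in finite_measure) dominated_moments_const: "dominated_moments M (\<lambda>_. c)"
  unfolding dominated_moments_def by (intro bexI[of _ "\<lambda>_. \<bar>c\<bar>"]) auto

lemma dominated_moments_add:
  assumes "dominated_moments M X" "dominated_moments M Y"
  shows "dominated_moments M (\<lambda>\<omega>. X \<omega> + Y \<omega>)"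
proof -
  obtain X' where X: "X' \<in> borel_measurable M" "AE \<omega> in M. \<bar>X \<omega>\<bar> \<le> X' \<omega>"
    "\<And>k. integrable M (\<lambda>\<omega>. \<bar>X' \<omega>\<bar> ^ k)"
    by (rule dominated_momentsE[OF assms(1)]) (rule that)
  obtain Y' where Y: "Y' \<in> borel_measurable M" "AE \<omega> in M. \<bar>Y \<omega>\<bar> \<le> Y' \<omega>"
    "\<And>k. integrable M (\<lambda>\<omega>. \<bar>Y' \<omega>\<bar> ^ k)"
    by (rule dominated_momentsE[OF assms(2)]) (rule that)
  note [measurable] = X(1) Y(1)
  have bound: "\<bar>a + b\<bar> ^ k \<le> 2 ^ k * (\<bar>a\<bar> ^ k + \<bar>b\<bar> ^ k)" for a b :: real and k
  proof -
    have "\<bar>a + b\<bar> ^ k \<le> (2 * max \<bar>a\<bar> \<bar>b\<bar>) ^ k"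
      by (intro power_mono) auto
    also have "\<dots> \<le> 2 ^ k * (\<bar>a\<bar> ^ k + \<bar>b\<bar> ^ k)"
      by (simp add: power_mult_distrib max_def)
    finally show ?thesis .
  qed
  have "integrable M (\<lambda>\<omega>. \<bar>X' \<omega> + Y' \<omega>\<bar> ^ k)" for k
    by (rule Bochner_Integration.integrable_bound
        [of _ "\<lambda>\<omega>. 2 ^ k * (\<bar>X' \<omega>\<bar> ^ k + \<bar>Y' \<omega>\<bar> ^ k)"])
      (use X(3) Y(3) bound in auto)
  moreover have "AE \<omega> in M. \<bar>X \<omega> + Y \<omega>\<bar> \<le> X' \<omega> + Y' \<omega>"
    using X(2) Y(2) by eventually_elim linarith
  ultimately show ?thesis
    unfolding dominated_moments_def by (intro bexI[of _ "\<lambda>\<omega>. X' \<omega> + Y' \<omega>"]) auto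
qed

lemma dominated_moments_mult:
  assumes "dominated_moments M X" "dominated_moments M Y"
  shows "dominated_moments M (\<lambda>\<omega>. X \<omega> * Y \<omega>)"
proof -
  obtain X' where X: "X' \<in> borel_measurable M" "AE \<omega> in M. \<bar>X \<omega>\<bar> \<le> X' \<omega>"
    "\<And>k. integrable M (\<lambda>\<omega>. \<bar>X' \<omega>\<bar> ^ k)"
    by (rule dominated_momentsE[OF assms(1)]) (rule that)
  obtain Y' where Y: "Y' \<in> borel_measurable M" "AE \<omega> in M. \<bar>Y \<omega>\<bar> \<le> Y' \<omega>"
    "\<And>k. integrable M (\<lambda>\<omega>. \<bar>Y' \<omega>\<bar> ^ k)"
    by (rule dominated_momentsE[OF assms(2)]) (rule that)
  note [measurable] = X(1) Y(1)
  have bound: "\<bar>a * b\<bar> ^ k \<le> \<bar>a\<bar> ^ (2 * k) + \<bar>b\<bar> ^ (2 * k)" for a b :: real and k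
  proof -
    have "\<bar>a * b\<bar> ^ k \<le> 2 * \<bar>a\<bar> ^ k * \<bar>b\<bar> ^ k"
      by (simp add: abs_mult power_mult_distrib)
    also have "\<dots> \<le> (\<bar>a\<bar> ^ k)\<^sup>2 + (\<bar>b\<bar> ^ k)\<^sup>2"
      by (rule sum_squares_bound)
    finally show ?thesis
      by (simp add: power_mult[symmetric] mult.commute)
  qed
  have "integrable M (\<lambda>\<omega>. \<bar>X' \<omega> * Y' \<omega>\<bar> ^ k)" for k
    by (rule Bochner_Integration.integrable_bound
        [of _ "\<lambda>\<omega>. \<bar>X' \<omega>\<bar> ^ (2 * k) + \<bar>Y' \<omega>\<bar> ^ (2 * k)"])
      (use X(3) Y(3) bound in auto)
  moreover have "AE \<omega> in M. \<bar>X \<omega> * Y \<omega>\<bar> \<le> X' \<omega> * Y' \<omega>"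
    using X(2) Y(2) by eventually_elim (auto simp: abs_mult intro!: mult_mono)
  ultimately show ?thesis
    unfolding dominated_moments_def by (intro bexI[of _ "\<lambda>\<omega>. X' \<omega> * Y' \<omega>"]) auto
qed

lemma (in finite_measure) dominated_moments_sum:
  assumes "\<And>i. i \<in> I \<Longrightarrow> dominated_moments M (X i)"
  shows "dominated_moments M (\<lambda>\<omega>. \<Sum>i\<in>I. X i \<omega>)"
  using assms
  by (induction I rule: infinite_finite_induct)
    (auto intro!: dominated_moments_add dominated_moments_const)

lemma dominated_moments_nn_integral:
  assumes "dominated_moments M X"
  shows "(\<integral>\<^sup>+\<omega>. ennreal (\<bar>X \<omega>\<bar> ^ k) \<partial>M) < \<infinity>"
proof -
  obtain Y where Y: "Y \<in> borel_measurable M" "AE \<omega> in M. \<bar>X \<omega>\<bar> \<le> Y \<omega>"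
    "\<And>k. integrable M (\<lambda>\<omega>. \<bar>Y \<omega>\<bar> ^ k)"
    by (rule dominated_momentsE[OF assms]) (rule that)
  have "AE \<omega> in M. \<bar>X \<omega>\<bar> ^ k \<le> \<bar>Y \<omega>\<bar> ^ k"
    using Y(2) by eventually_elim (auto intro: power_mono)
  then have "(\<integral>\<^sup>+\<omega>. ennreal (\<bar>X \<omega>\<bar> ^ k) \<partial>M) \<le> (\<integral>\<^sup>+\<omega>. ennreal (\<bar>Y \<omega>\<bar> ^ k) \<partial>M)"
    by (intro nn_integral_mono_AE) (auto simp: ennreal_leI)
  also have "\<dots> < \<infinity>"
    using Y(3)[of k] by (auto simp: integrable_iff_bounded)
  finally show ?thesis .
qed

section \<open>Gaussian series in an inner product space\<close>

lemma weighted_sum_power_le: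
  fixes q x :: "'i \<Rightarrow> real"
  assumes "finite I" "\<And>i. i \<in> I \<Longrightarrow> 0 \<le> q i" "\<And>i. i \<in> I \<Longrightarrow> 0 \<le> x i"
  shows "(\<Sum>i\<in>I. q i * x i) ^ Suc l \<le> (\<Sum>i\<in>I. q i) ^ l * (\<Sum>i\<in>I. q i * x i ^ Suc l)"
proof (cases "(\<Sum>i\<in>I. q i) = 0")
  case True
  then have "\<And>i. i \<in> I \<Longrightarrow> q i = 0"
    using assms by (simp add: sum_nonneg_eq_0_iff)
  then show ?thesis by simp
next
  case False
  define S where "S = (\<Sum>i\<in>I. q i)"
  have S: "S > 0"
    using False sum_nonneg[of I q] assms(2) by (simp add: S_def less_le)
  have conv: "convex_on {0..} (\<lambda>x::real. x ^ Suc l)"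
  proof (cases "even (Suc l)")
    case True
    then show ?thesis
      by (intro convex_on_subset[OF convex_power_even]) auto
  qed (rule convex_power_odd)
  have "(\<Sum>i\<in>I. (q i / S) *\<^sub>R x i) ^ Suc l \<le> (\<Sum>i\<in>I. (q i / S) * x i ^ Suc l)"
  proof (rule convex_on_sum[OF assms(1) _ conv])
    show "I \<noteq> {}" using False by auto
    show "(\<Sum>i\<in>I. q i / S) = 1"
      using S by (simp add: sum_divide_distrib[symmetric] S_def[symmetric])
  qed (use S assms in auto)
  also have "(\<Sum>i\<in>I. (q i / S) *\<^sub>R x i) = (\<Sum>i\<in>I. q i * x i) / S"
    by (simp add: sum_divide_distrib)
  also have "(\<Sum>i\<in>I. (q i / S) * x i ^ Suc l) = (\<Sum>i\<in>I. q i * x i ^ Suc l) / S"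
    by (simp add: sum_divide_distrib)
  finally have "(\<Sum>i\<in>I. q i * x i) ^ Suc l \<le> (\<Sum>i\<in>I. q i * x i ^ Suc l) / S * S ^ Suc l"
    using S unfolding power_divide by (subst (asm) pos_divide_le_eq) auto
  also have "\<dots> = S ^ l * (\<Sum>i\<in>I. q i * x i ^ Suc l)"
    using S by simp
  finally show ?thesis
    by (simp add: S_def)
qed

lemma norm_sq_orthonormal_sums:
  fixes e :: "nat \<Rightarrow> 'b::real_inner"
  assumes e: "\<And>i j. e i \<bullet> e j = (if i = j then 1 else 0)"
    and D: "(\<lambda>j. c j *\<^sub>R e j) sums D"
  shows "(\<lambda>j. (c j)\<^sup>2) sums (norm D)\<^sup>2"
proof -
  have "(norm (\<Sum>j<N. c j *\<^sub>R e j))\<^sup>2 = (\<Sum>j<N. (c j)\<^sup>2)" for N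
    by (subst norm_sum_Pythagorean)
      (auto simp: pairwise_def orthogonal_def e power_mult_distrib power2_norm_eq_inner)
  moreover have "(\<lambda>N. (norm (\<Sum>j<N. c j *\<^sub>R e j))\<^sup>2) \<longlonglongrightarrow> (norm D)\<^sup>2"
    using D unfolding sums_def by (intro tendsto_intros)
  ultimately show ?thesis
    by (simp add: sums_def)
qed

text \<open>The coefficients \<open>X j\<close> need not be independent.\<close>

lemma (in prob_space) dominated_moments_gaussian_series:
  fixes e :: "nat \<Rightarrow> 'b::real_inner" and X :: "nat \<Rightarrow> 'a \<Rightarrow> real"
  assumes e: "\<And>i j. e i \<bullet> e j = (if i = j then 1 else 0)"
    and q: "\<And>j. 0 \<le> q j" "summable q"
    and "0 < \<sigma>" and X: "\<And>j. distributed M lborel (X j) (normal_density 0 \<sigma>)"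
    and D: "AE \<omega> in M. (\<lambda>j. (sqrt (q j) * X j \<omega>) *\<^sub>R e j) sums D \<omega>"
  shows "dominated_moments M (\<lambda>\<omega>. (norm (D \<omega>))\<^sup>2)"
proof -
  have Xm [measurable]: "X j \<in> borel_measurable M" for j
    using distributed_measurable[OF X[of j]] by simp
  define Y where "Y \<omega> = (\<Sum>j. q j * (X j \<omega>)\<^sup>2)" for \<omega>
  have Ym [measurable]: "Y \<in> borel_measurable M"
    unfolding Y_def by measurable
  have sums: "AE \<omega> in M. (\<lambda>j. q j * (X j \<omega>)\<^sup>2) sums (norm (D \<omega>))\<^sup>2"
    using D
  proof eventually_elim
    case (elim \<omega>)
    show ?case
      using norm_sq_orthonormal_sums[OF e elim] q(1) by (simp add: power_mult_distrib)
  qed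
  have "integrable M (\<lambda>\<omega>. \<bar>Y \<omega>\<bar> ^ k)" for k
  proof (cases k)
    case (Suc l)
    define S where "S = suminf q"
    have S: "S \<ge> 0"
      unfolding S_def using q by (intro suminf_nonneg) auto
    define K where "K = (\<integral>x. normal_density 0 \<sigma> x * (x - 0) ^ (2 * k) \<partial>lborel)"
    have K: "K \<ge> 0"
      unfolding K_def by (intro integral_nonneg_AE AE_I2) (auto intro!: mult_nonneg_nonneg)
    have mom: "(\<integral>\<^sup>+\<omega>. ennreal ((X j \<omega>) ^ (2 * k)) \<partial>M) = ennreal K" for j
    proof -
      have "(\<integral>\<^sup>+\<omega>. ennreal ((X j \<omega>) ^ (2 * k)) \<partial>M)
          = (\<integral>\<^sup>+x. ennreal (normal_density 0 \<sigma> x) * ennreal (x ^ (2 * k)) \<partial>lborel)"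
        by (intro distributed_nn_integral[OF X, symmetric]) simp
      also have "\<dots> = (\<integral>\<^sup>+x. ennreal (normal_density 0 \<sigma> x * (x - 0) ^ (2 * k)) \<partial>lborel)"
        by (simp add: ennreal_mult)
      also have "\<dots> = ennreal K"
        unfolding K_def
        by (rule nn_integral_eq_integral[OF integrable_normal_moment[OF \<open>0 < \<sigma>\<close>]])
          (auto intro!: mult_nonneg_nonneg)
      finally show ?thesis .
    qed
    have le: "AE \<omega> in M. ennreal (\<bar>Y \<omega>\<bar> ^ k)
        \<le> ennreal (S ^ l) * (\<Sum>j. ennreal (q j) * ennreal ((X j \<omega>) ^ (2 * k)))"
      using sums
    proof eventually_elim
      case (elim \<omega>)
      let ?R = "\<lambda>N. \<Sum>j<N. q j * (X j \<omega>) ^ (2 * k)"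
      have Y: "Y \<omega> \<ge> 0"
        unfolding Y_def using elim q(1) by (intro suminf_nonneg) (auto simp: sums_iff)
      have part: "ennreal ((\<Sum>j<N. q j * (X j \<omega>)\<^sup>2) ^ k)
          \<le> ennreal (S ^ l) * (\<Sum>j. ennreal (q j) * ennreal ((X j \<omega>) ^ (2 * k)))" for N
      proof -
        have "(\<Sum>j<N. q j * (X j \<omega>)\<^sup>2) ^ k \<le> (\<Sum>j<N. q j) ^ l * ?R N"
          unfolding Suc power_mult by (intro weighted_sum_power_le) (use q(1) in auto)
        also have "\<dots> \<le> S ^ l * ?R N"
          unfolding S_def using q
          by (intro mult_right_mono power_mono sum_le_suminf sum_nonneg) auto
        finally have "ennreal ((\<Sum>j<N. q j * (X j \<omega>)\<^sup>2) ^ k) \<le> ennreal (S ^ l * ?R N)"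
          by (rule ennreal_leI)
        also have "\<dots> = ennreal (S ^ l) * (\<Sum>j<N. ennreal (q j) * ennreal ((X j \<omega>) ^ (2 * k)))"
          using S q(1)
          by (simp add: ennreal_mult sum_nonneg sum_ennreal[symmetric] del: sum_ennreal)
        also have "\<dots> \<le> ennreal (S ^ l) * (\<Sum>j. ennreal (q j) * ennreal ((X j \<omega>) ^ (2 * k)))"
          by (intro mult_left_mono sum_le_suminf) auto
        finally show ?thesis .
      qed
      have "(\<lambda>N. ennreal ((\<Sum>j<N. q j * (X j \<omega>)\<^sup>2) ^ k)) \<longlonglongrightarrow> ennreal (Y \<omega> ^ k)"
        using elim unfolding Y_def
        by (intro tendsto_intros tendsto_ennrealI) (simp add: sums_def sums_unique[OF elim, symmetric])
      then show ?case
        using Y part by (auto intro: LIMSEQ_le_const2)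
    qed
    have "(\<integral>\<^sup>+\<omega>. ennreal (\<bar>Y \<omega>\<bar> ^ k) \<partial>M)
        \<le> (\<integral>\<^sup>+\<omega>. ennreal (S ^ l) * (\<Sum>j. ennreal (q j) * ennreal ((X j \<omega>) ^ (2 * k))) \<partial>M)"
      by (rule nn_integral_mono_AE[OF le])
    also have "\<dots> = ennreal (S ^ l) * (\<Sum>j. ennreal (q j) * ennreal K)"
      by (simp add: nn_integral_cmult nn_integral_suminf mom)
    also have "(\<Sum>j. ennreal (q j) * ennreal K) = ennreal (S * K)"
      unfolding S_def using q K
      by (simp add: ennreal_suminf_multc suminf_ennreal2 ennreal_mult suminf_nonneg)
    finally have "(\<integral>\<^sup>+\<omega>. ennreal (\<bar>Y \<omega>\<bar> ^ k) \<partial>M) < \<infinity>"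
      by (simp add: ennreal_mult_less_top le_less_trans)
    then show ?thesis
      by (simp add: integrable_iff_bounded)
  qed simp
  moreover have "AE \<omega> in M. \<bar>(norm (D \<omega>))\<^sup>2\<bar> \<le> Y \<omega>"
    using sums by eventually_elim (simp add: Y_def sums_iff)
  ultimately show ?thesis
    unfolding dominated_moments_def by (intro bexI[of _ Y]) auto
qed

lemma (in prob_space) dominated_moments_wiener_increment:
  assumes Q: "covariance_op Q q e" and W: "Q_wiener M F q e \<beta> W" and st: "0 \<le> s" "s < t"
  shows "dominated_moments M (\<lambda>\<omega>. (norm (W t \<omega> - W s \<omega>))\<^sup>2)"
proof (rule dominated_moments_gaussian_series)
  show e: "e i \<bullet> e j = (if i = j then 1 else 0)" for i j
    using Q by (auto simp: covariance_op_def orthonormal_basis_def)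
  show "0 \<le> q j" for j
  proof -
    have "e j \<noteq> 0"
      using e[of j j] by auto
    then have "0 < Q (e j) \<bullet> e j"
      using Q by (auto simp: covariance_op_def)
    also have "Q (e j) \<bullet> e j = q j"
      using Q e[of j j] by (auto simp: covariance_op_def)
    finally show ?thesis by simp
  qed
  show "0 < sqrt (t - s)"
    using st by simp
  show "summable q"
    using Q by (auto simp: covariance_op_def)
  show "distributed M lborel (\<lambda>\<omega>. \<beta> j t \<omega> - \<beta> j s \<omega>) (normal_density 0 (sqrt (t - s)))" for j
    using W st by (auto simp: Q_wiener_def standard_brownian_motion_def)
  have "AE \<omega> in M. (\<lambda>j. (sqrt (q j) * \<beta> j r \<omega>) *\<^sub>R e j) sums W r \<omega>" if "r \<ge> 0" for r
    using W that by (auto simp: Q_wiener_def)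
  from this[of s] this[of t] st
  have "AE \<omega> in M. (\<lambda>j. (sqrt (q j) * \<beta> j s \<omega>) *\<^sub>R e j) sums W s \<omega>"
    "AE \<omega> in M. (\<lambda>j. (sqrt (q j) * \<beta> j t \<omega>) *\<^sub>R e j) sums W t \<omega>"
    by auto
  then show "AE \<omega> in M. (\<lambda>j. (sqrt (q j) * (\<beta> j t \<omega> - \<beta> j s \<omega>)) *\<^sub>R e j) sums (W t \<omega> - W s \<omega>)"
  proof eventually_elim
    case (elim \<omega>)
    from sums_diff[OF elim(2,1)] show ?case
      by (simp add: algebra_simps)
  qed
qed

section \<open>Bound for the noise term\<close>

lemma norm_matrix_vector_mult_le:
  fixes A :: "real^'n^'m"
  shows "norm (A *v x) \<le> norm A * norm x"
proof -
  have "(norm (A *v x))\<^sup>2 = (\<Sum>i\<in>UNIV. (A $ i \<bullet> x)\<^sup>2)"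
    by (simp add: norm_vec_def L2_set_def sum_nonneg matrix_vector_mul_component)
  also have "\<dots> \<le> (\<Sum>i\<in>UNIV. (norm (A $ i))\<^sup>2 * (norm x)\<^sup>2)"
    by (intro sum_mono) (metis Cauchy_Schwarz_ineq power2_norm_eq_inner)
  also have "\<dots> = (norm A * norm x)\<^sup>2"
    by (simp add: norm_vec_def[of A] L2_set_def sum_nonneg sum_distrib_right power_mult_distrib)
  finally show ?thesis
    by (rule power2_le_imp_le) simp
qed

lemma square_integrable_rep_l2: "square_integrable (rep_l2 f)"
  using Quotient_rep_reflp[OF Quotient_l2, of f] by (simp add: l2_eq_def)

lemma norm_sq_l2: "(norm f)\<^sup>2 = (\<integral>x. (norm (rep_l2 f x))\<^sup>2 \<partial>square_measure)"
  by (simp add: power2_norm_eq_inner inner_l2_def)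

lemma norm_sq_abs_l2:
  assumes "square_integrable f"
  shows "(norm (abs_l2 f))\<^sup>2 = (\<integral>x. (norm (f x))\<^sup>2 \<partial>square_measure)"
proof -
  have "l2_eq f f"
    using assms by (simp add: l2_eq_def)
  then show ?thesis
    by (simp add: power2_norm_eq_inner inner_l2.abs_eq)
qed

lemma norm_pointwise_mult_le:
  assumes "linf_norm A \<le> ereal C" "0 \<le> C"
  shows "norm (pointwise_mult A v) \<le> C * norm v"
proof (cases "square_integrable (\<lambda>x. rep_l2 A x *v rep_l2 v x)")
  case True
  have "AE x in square_measure. ereal (norm (rep_l2 A x)) \<le> linf_norm A"
    unfolding linf_norm_def by (rule esssup_AE)
  then have le: "AE x in square_measure.
      (norm (rep_l2 A x *v rep_l2 v x))\<^sup>2 \<le> C\<^sup>2 * (norm (rep_l2 v x))\<^sup>2"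
  proof eventually_elim
    case (elim x)
    then have "norm (rep_l2 A x) \<le> C"
      using assms(1) by (metis ereal_less_eq(3) order_trans)
    then have "norm (rep_l2 A x *v rep_l2 v x) \<le> C * norm (rep_l2 v x)"
      by (intro order_trans[OF norm_matrix_vector_mult_le] mult_right_mono) auto
    then show ?case
      by (metis norm_ge_zero power_mono power_mult_distrib)
  qed
  have "(norm (pointwise_mult A v))\<^sup>2
      = (\<integral>x. (norm (rep_l2 A x *v rep_l2 v x))\<^sup>2 \<partial>square_measure)"
    using True by (simp add: pointwise_mult_def l2_of_def norm_sq_abs_l2)
  also have "\<dots> \<le> (\<integral>x. C\<^sup>2 * (norm (rep_l2 v x))\<^sup>2 \<partial>square_measure)"
    using le True square_integrable_rep_l2[of v]
    by (intro integral_mono_AE) (auto simp: square_integrable_def)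
  also have "\<dots> = (C * norm v)\<^sup>2"
    by (simp add: norm_sq_l2 power_mult_distrib)
  finally show ?thesis
    by (rule power2_le_imp_le) (use assms(2) in simp)
next
  case False
  then show ?thesis
    using assms(2) by (simp add: pointwise_mult_def l2_of_def)
qed

section \<open>Energy estimate for one time step\<close>

text \<open>The modified energy, which the scheme without noise does not increase. The pressure enters
  through its gradient, with the weight \<open>\<tau>\<^sup>2\<close> produced by the projection step.\<close>

definition energy :: "real \<Rightarrow> vfield \<Rightarrow> real l2 \<Rightarrow> real \<Rightarrow> real \<Rightarrow> real" where
  "energy \<tau> u p \<xi> \<eta> = (norm u)\<^sup>2 + \<tau>\<^sup>2 * (norm (grad p))\<^sup>2 + \<xi>\<^sup>2 + \<eta>\<^sup>2"

lemma scheme_step_energy: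
  assumes step: "scheme_step \<tau> g \<delta> u p \<xi> \<eta> ut' u' p' \<xi>' \<eta>'"
  defines "G \<equiv> pointwise_mult (g u) \<delta>"
  shows "energy \<tau> u' p' \<xi>' \<eta>' + 4 * (\<tau> * (norm (vgrad ut'))\<^sup>2)
    \<le> 2 * energy \<tau> u p \<xi> \<eta> + 4 * (G \<bullet> u + (norm G)\<^sup>2)\<^sup>2"
proof -
  have mom: "(ut' - u) \<bullet> ut' = \<eta>' * (G \<bullet> ut') - \<tau> * (norm (vgrad ut'))\<^sup>2
      - \<tau> * \<xi>' * convection_pairing u ut' - \<tau> * (grad p \<bullet> ut')"
    using step by (auto simp: scheme_step_def G_def power2_norm_eq_inner)
  have xi: "\<xi>' * (\<xi>' - \<xi>) = \<tau> * \<xi>' * convection_pairing u ut'"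
    using step by (simp add: scheme_step_def)
  have eta: "\<eta>' * (\<eta>' - \<eta>) = \<eta>' * (G \<bullet> u + (norm G)\<^sup>2) - \<eta>' * (G \<bullet> ut')"
  proof -
    have "\<eta>' - \<eta> = - (G \<bullet> (ut' - u - G))"
      using step by (simp add: scheme_step_def G_def)
    also have "\<dots> = (G \<bullet> u + (norm G)\<^sup>2) - G \<bullet> ut'"
      by (simp add: inner_diff_right power2_norm_eq_inner)
    finally show ?thesis
      by (simp only: right_diff_distrib)
  qed
  have orth: "u' \<bullet> grad p' = 0"
  proof -
    have "div_field u' = 0" "normal_trace u' p' = 0"
      using step by (auto simp: scheme_step_def space_V_def)
    then show ?thesis
      by (simp add: normal_trace_def)
  qed
  have "u' + \<tau> *\<^sub>R grad p' = ut' + \<tau> *\<^sub>R grad p"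
    using step by (simp add: scheme_step_def algebra_simps)
  moreover have "(norm (x + \<tau> *\<^sub>R y))\<^sup>2 = (norm x)\<^sup>2 + \<tau>\<^sup>2 * (norm y)\<^sup>2 + 2 * (\<tau> * (y \<bullet> x))"
    for x y :: vfield
    unfolding power2_norm_eq_inner
    by (simp add: inner_add_left inner_add_right inner_commute power2_eq_square algebra_simps)
  ultimately have proj: "(norm u')\<^sup>2 + \<tau>\<^sup>2 * (norm (grad p'))\<^sup>2
      = (norm ut')\<^sup>2 + \<tau>\<^sup>2 * (norm (grad p))\<^sup>2 + 2 * (\<tau> * (grad p \<bullet> ut'))"
    using orth by (metis add.right_neutral inner_commute mult_zero_right)
  have polar: "2 * ((ut' - u) \<bullet> ut') = (norm ut')\<^sup>2 - (norm u)\<^sup>2 + (norm (ut' - u))\<^sup>2"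
    by (simp add: power2_norm_eq_inner inner_diff_left inner_diff_right inner_commute)
  have polar': "a\<^sup>2 - b\<^sup>2 \<le> 2 * (a * (a - b))" for a b :: real
    using zero_le_power2[of "a - b"] by (simp add: power2_eq_square algebra_simps)
  define R where "R = G \<bullet> u + (norm G)\<^sup>2"
  \<comment> \<open>Young's inequality, weighted so that it uses up half of the term in \<open>\<eta>'\<^sup>2\<close> of the energy balance.\<close>
  have young: "4 * (\<eta>' * R) \<le> \<eta>'\<^sup>2 + 4 * R\<^sup>2"
    using sum_squares_bound[of \<eta>' "2 * R"] by (simp add: power_mult_distrib)
  have nonneg: "0 \<le> (norm (ut' - u))\<^sup>2" "0 \<le> (norm u')\<^sup>2 + \<tau>\<^sup>2 * (norm (grad p'))\<^sup>2" "0 \<le> \<xi>'\<^sup>2"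
    by auto
  have "2 * (\<eta>' * (G \<bullet> ut')) \<le> 2 * (\<eta>' * R) - \<eta>'\<^sup>2 + \<eta>\<^sup>2"
    using polar'[of \<eta>' \<eta>] eta unfolding R_def by simp
  moreover have "\<xi>'\<^sup>2 - \<xi>\<^sup>2 \<le> 2 * (\<tau> * \<xi>' * convection_pairing u ut')"
    using polar'[of \<xi>' \<xi>] xi by simp
  moreover have "(norm ut')\<^sup>2 - (norm u)\<^sup>2 \<le> 2 * (\<eta>' * (G \<bullet> ut'))
      - 2 * (\<tau> * (norm (vgrad ut'))\<^sup>2) - 2 * (\<tau> * \<xi>' * convection_pairing u ut')
      - 2 * (\<tau> * (grad p \<bullet> ut'))"
    using mom polar nonneg(1) by argo
  ultimately show ?thesis
    unfolding energy_def R_def[symmetric] using proj young nonneg(2,3) by argo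
qed

text \<open>\<open>E\<close> is the old energy and \<open>N\<close> the squared norm of the noise increment.\<close>

lemma scheme_step_energy_noise:
  fixes u \<delta> :: vfield
  assumes step: "scheme_step \<tau> g \<delta> u p \<xi> \<eta> ut' u' p' \<xi>' \<eta>'"
    and g: "noise_coefficient Q e C g" and "0 \<le> C" and u: "u \<in> space_H"
  defines "E \<equiv> energy \<tau> u p \<xi> \<eta>" and "N \<equiv> (norm \<delta>)\<^sup>2"
  shows "energy \<tau> u' p' \<xi>' \<eta>' + 4 * (\<tau> * (norm (vgrad ut'))\<^sup>2)
    \<le> 2 * E + 8 * C\<^sup>2 * (N * E) + 8 * C ^ 4 * (N * N)"
proof -
  define G where "G = pointwise_mult (g u) \<delta>"
  have "norm G \<le> C * norm \<delta>"
    unfolding G_def using g u \<open>0 \<le> C\<close>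
    by (intro norm_pointwise_mult_le) (auto simp: noise_coefficient_def)
  then have "(norm G)\<^sup>2 \<le> (C * norm \<delta>)\<^sup>2"
    by (intro power_mono) auto
  then have GN: "(norm G)\<^sup>2 \<le> C\<^sup>2 * N"
    by (simp add: N_def power_mult_distrib)
  have uE: "(norm u)\<^sup>2 \<le> E"
    by (simp add: E_def energy_def)
  have "(G \<bullet> u)\<^sup>2 \<le> (norm G)\<^sup>2 * (norm u)\<^sup>2"
    using Cauchy_Schwarz_ineq[of G u] by (simp add: power2_norm_eq_inner)
  also have "\<dots> \<le> (C\<^sup>2 * N) * E"
    using GN uE by (intro mult_mono) (auto simp: N_def)
  finally have 1: "(G \<bullet> u)\<^sup>2 \<le> (C\<^sup>2 * N) * E" .
  have 2: "((norm G)\<^sup>2)\<^sup>2 \<le> (C\<^sup>2 * N)\<^sup>2"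
    using GN by (intro power_mono) auto
  have 3: "(G \<bullet> u + (norm G)\<^sup>2)\<^sup>2 \<le> 2 * (G \<bullet> u)\<^sup>2 + 2 * ((norm G)\<^sup>2)\<^sup>2"
    using sum_squares_bound[of "G \<bullet> u" "(norm G)\<^sup>2"] by (simp add: power2_sum)
  have 4: "(C\<^sup>2 * N)\<^sup>2 = C ^ 4 * (N * N)"
    by (simp add: power_mult_distrib power2_eq_square power4_eq_xxxx)
  have "energy \<tau> u' p' \<xi>' \<eta>' + 4 * (\<tau> * (norm (vgrad ut'))\<^sup>2)
      \<le> 2 * E + 4 * (G \<bullet> u + (norm G)\<^sup>2)\<^sup>2"
    using scheme_step_energy[OF step] by (simp add: E_def G_def)
  also have "\<dots> \<le> 2 * E + 8 * C\<^sup>2 * (N * E) + 8 * C ^ 4 * (N * N)"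
    using 1 2 3 4 by (simp add: mult.assoc)
  finally show ?thesis .
qed

section \<open>Moments of the discrete solution\<close>

lemma space_V_subset_space_H: "space_V \<subseteq> space_H"
  by (auto simp: space_V_def space_H_def)

theorem lemma6:
  fixes M :: "'w measure" and F :: "real \<Rightarrow> 'w measure"
    and Q :: "vfield \<Rightarrow> vfield" and q :: "nat \<Rightarrow> real" and e :: "nat \<Rightarrow> vfield"
    and \<beta> :: "nat \<Rightarrow> real \<Rightarrow> 'w \<Rightarrow> real" and W :: "real \<Rightarrow> 'w \<Rightarrow> vfield"
    and g :: "vfield \<Rightarrow> mfield" and C T \<tau> :: real
    and u0 :: vfield and p0 :: "real l2"
    and ut u :: "nat \<Rightarrow> 'w \<Rightarrow> vfield" and p :: "nat \<Rightarrow> 'w \<Rightarrow> real l2"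
    and \<xi> \<eta> :: "nat \<Rightarrow> 'w \<Rightarrow> real" and m n :: nat
  assumes "filtered_prob_space M F"
    and "covariance_op Q q e"
    and "Q_wiener M F q e \<beta> W"
    and "C > 0" and "noise_coefficient Q e C g"
    and "T > 0" and "\<tau> > 0"
    and "u0 \<in> space_V" and "p0 \<in> H1"
    and "scheme_solution M T \<tau> g W u0 p0 ut u p \<xi> \<eta>"
    and "m \<ge> 1" and "real (n + 1) * \<tau> \<le> T"
  shows "(\<integral>\<^sup>+\<omega>. ennreal (norm (u (n + 1) \<omega>) ^ (2 * m)) \<partial>M)
       + (\<integral>\<^sup>+\<omega>. ennreal ((\<tau> * (\<Sum>j=0..n. (norm (vgrad (ut (j + 1) \<omega>)))\<^sup>2)) ^ m) \<partial>M)
       + (\<integral>\<^sup>+\<omega>. ennreal (\<bar>\<xi> (n + 1) \<omega>\<bar> ^ (2 * m)) \<partial>M)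
       + (\<integral>\<^sup>+\<omega>. ennreal (\<bar>\<eta> (n + 1) \<omega>\<bar> ^ (2 * m)) \<partial>M)
       + ennreal (\<tau> ^ (2 * m)) * (\<integral>\<^sup>+\<omega>. ennreal (norm (grad (p (n + 1) \<omega>)) ^ (2 * m)) \<partial>M)
       < \<infinity>"
proof -
  interpret prob_space M
    using assms(1) by (simp add: filtered_prob_space_def)
  define t where "t k = real k * \<tau>" for k
  define N where "N k \<omega> = (norm (W (t (Suc k)) \<omega> - W (t k) \<omega>))\<^sup>2" for k \<omega>
  define E where "E k \<omega> = energy \<tau> (u k \<omega>) (p k \<omega>) (\<xi> k \<omega>) (\<eta> k \<omega>)" for k \<omega>
  define V where "V k \<omega> = \<tau> * (norm (vgrad (ut (Suc k) \<omega>)))\<^sup>2" for k \<omega>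
  have E_nonneg: "0 \<le> E k \<omega>" for k \<omega>
    by (simp add: E_def energy_def)
  have V_nonneg: "0 \<le> V k \<omega>" for k \<omega>
    using \<open>\<tau> > 0\<close> by (simp add: V_def)
  have N_mom: "dominated_moments M (N k)" for k
    unfolding N_def t_def using \<open>\<tau> > 0\<close>
    by (intro dominated_moments_wiener_increment[OF assms(2,3)]) auto
  have time: "real (Suc k) * \<tau> \<le> T" if "k \<le> n" for k
  proof -
    have "real (Suc k) * \<tau> \<le> real (n + 1) * \<tau>"
      using that \<open>\<tau> > 0\<close> by (intro mult_right_mono) auto
    then show ?thesis
      using assms(12) by linarith
  qed
  have step: "AE \<omega> in M. scheme_step \<tau> g (W (t (Suc k)) \<omega> - W (t k) \<omega>)
      (u k \<omega>) (p k \<omega>) (\<xi> k \<omega>) (\<eta> k \<omega>)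
      (ut (Suc k) \<omega>) (u (Suc k) \<omega>) (p (Suc k) \<omega>) (\<xi> (Suc k) \<omega>) (\<eta> (Suc k) \<omega>)"
    if "k \<le> n" for k
    using assms(10) time[OF that] unfolding scheme_solution_def t_def by blast
  have init: "u 0 \<omega> = u0 \<and> p 0 \<omega> = p0 \<and> \<xi> 0 \<omega> = 1 \<and> \<eta> 0 \<omega> = 1" if "\<omega> \<in> space M" for \<omega>
    using assms(10) that by (simp add: scheme_solution_def)
  have uH: "AE \<omega> in M. u k \<omega> \<in> space_H" if "k \<le> n" for k
  proof (cases k)
    case 0
    then show ?thesis
      using init assms(8) space_V_subset_space_H by (intro AE_I2) auto
  next
    case (Suc i)
    then show ?thesis
      using step[of i] that space_V_subset_space_H by (auto simp: scheme_step_def)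
  qed
  have bound: "AE \<omega> in M. E (Suc k) \<omega> + 4 * V k \<omega>
      \<le> 2 * E k \<omega> + 8 * C\<^sup>2 * (N k \<omega> * E k \<omega>) + 8 * C ^ 4 * (N k \<omega> * N k \<omega>)" if "k \<le> n" for k
    using step[OF that] uH[OF that]
  proof eventually_elim
    case (elim \<omega>)
    show ?case
      using scheme_step_energy_noise[OF elim(1) assms(5) _ elim(2)] \<open>C > 0\<close>
      by (simp add: E_def V_def N_def)
  qed
  have step_mom: "dominated_moments M (\<lambda>\<omega>. E (Suc k) \<omega> + 4 * V k \<omega>)"
    if "k \<le> n" "dominated_moments M (E k)" for k
  proof (rule dominated_moments_mono_AE)
    show "dominated_moments M
        (\<lambda>\<omega>. 2 * E k \<omega> + 8 * C\<^sup>2 * (N k \<omega> * E k \<omega>) + 8 * C ^ 4 * (N k \<omega> * N k \<omega>))"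
      by (intro dominated_moments_add dominated_moments_mult dominated_moments_const N_mom that(2))
    show "AE \<omega> in M. \<bar>E (Suc k) \<omega> + 4 * V k \<omega>\<bar>
        \<le> 2 * E k \<omega> + 8 * C\<^sup>2 * (N k \<omega> * E k \<omega>) + 8 * C ^ 4 * (N k \<omega> * N k \<omega>)"
      using bound[OF that(1)] by eventually_elim (use E_nonneg V_nonneg in simp)
  qed
  have E_mom: "dominated_moments M (E k)" if "k \<le> Suc n" for k
    using that
  proof (induction k)
    case 0
    show ?case
      by (rule dominated_moments_mono_AE[OF dominated_moments_const[of "energy \<tau> u0 p0 1 1"]])
        (use init in \<open>auto simp: E_def energy_def\<close>)
  next
    case (Suc k)
    then have "dominated_moments M (\<lambda>\<omega>. E (Suc k) \<omega> + 4 * V k \<omega>)"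
      by (intro step_mom) auto
    then show ?case
      by (rule dominated_moments_mono_AE) (use E_nonneg V_nonneg in auto)
  qed
  have V_mom: "dominated_moments M (V k)" if "k \<le> n" for k
  proof (rule dominated_moments_mono_AE)
    show "dominated_moments M (\<lambda>\<omega>. E (Suc k) \<omega> + 4 * V k \<omega>)"
      using that by (intro step_mom E_mom) auto
    show "AE \<omega> in M. \<bar>V k \<omega>\<bar> \<le> E (Suc k) \<omega> + 4 * V k \<omega>"
    proof (rule AE_I2)
      fix \<omega>
      show "\<bar>V k \<omega>\<bar> \<le> E (Suc k) \<omega> + 4 * V k \<omega>"
        using E_nonneg[of "Suc k" \<omega>] V_nonneg[of k \<omega>] by simp
    qed
  qed
  have square: "(\<integral>\<^sup>+\<omega>. ennreal (\<bar>x \<omega>\<bar> ^ (2 * m)) \<partial>M) < \<infinity>"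
    if "\<And>\<omega>. c * (x \<omega>)\<^sup>2 \<le> E (n + 1) \<omega>" "c > 0" for x c
  proof -
    have "dominated_moments M (\<lambda>\<omega>. inverse c * E (n + 1) \<omega>)"
      by (intro dominated_moments_mult dominated_moments_const E_mom) auto
    then have "dominated_moments M (\<lambda>\<omega>. (x \<omega>)\<^sup>2)"
      by (rule dominated_moments_mono_AE) (use that in \<open>auto simp: field_simps\<close>)
    from dominated_moments_nn_integral[OF this, of m] show ?thesis
      by (simp add: power_mult)
  qed
  have "(\<integral>\<^sup>+\<omega>. ennreal (norm (u (n + 1) \<omega>) ^ (2 * m)) \<partial>M) < \<infinity>"
    using square[of 1 "\<lambda>\<omega>. norm (u (n + 1) \<omega>)"] by (simp add: E_def energy_def)
  moreover have "(\<integral>\<^sup>+\<omega>. ennreal (\<bar>\<xi> (n + 1) \<omega>\<bar> ^ (2 * m)) \<partial>M) < \<infinity>"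
    using square[of 1 "\<xi> (n + 1)"] by (simp add: E_def energy_def)
  moreover have "(\<integral>\<^sup>+\<omega>. ennreal (\<bar>\<eta> (n + 1) \<omega>\<bar> ^ (2 * m)) \<partial>M) < \<infinity>"
    using square[of 1 "\<eta> (n + 1)"] by (simp add: E_def energy_def)
  moreover have "(\<integral>\<^sup>+\<omega>. ennreal (norm (grad (p (n + 1) \<omega>)) ^ (2 * m)) \<partial>M) < \<infinity>"
    using square[of "\<tau>\<^sup>2" "\<lambda>\<omega>. norm (grad (p (n + 1) \<omega>))"] \<open>\<tau> > 0\<close>
    by (simp add: E_def energy_def)
  moreover have "(\<integral>\<^sup>+\<omega>. ennreal ((\<tau> * (\<Sum>j=0..n. (norm (vgrad (ut (j + 1) \<omega>)))\<^sup>2)) ^ m) \<partial>M) < \<infinity>"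
  proof -
    have "dominated_moments M (\<lambda>\<omega>. \<Sum>j=0..n. V j \<omega>)"
      by (intro dominated_moments_sum V_mom) auto
    from dominated_moments_nn_integral[OF this, of m] show ?thesis
      using V_nonneg by (simp add: sum_nonneg) (simp add: V_def sum_distrib_left)
  qed
  ultimately show ?thesis
    by (simp add: ennreal_mult_less_top)
qed

end
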